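(* Let $G(V,E,P)$ be a social network, $\theta$ a cut-off probability, and let $(\mathcal{N},\nu)$ be the associated BIM Game, i.e. $\mathcal{N}=V(G)$ and $\nu(S)=\sigma(S)$ for every $S\subseteq V(G)$, where $\sigma(S)$ is the expected influence of $S$ under the MIA diffusion model. Then the game $(\mathcal{N},\nu)$ is not convex.
   Context: A social network is a finite graph $G(V,E,P)$ with $V(G)=\{u_1,\dots,u_n\}$ and $P:E(G)\to(0,1]$; $P_{uv}$ is the influence probability of the edge $(uv)$ (an undirected edge is treated as two oppositely directed edges with the same probability), and $P_{uv}=0$ if $(uv)\notin E(G)$. Propagation probability: for a path $p$ in $G$, $\mathcal{P}(p)$ is the product of the influence probabilities of its edges. For $u\ne v$, $p^{max}_{u,v}$ is a path from $u$ to $v$ maximizing $\mathcal{P}$ (if a path exists; otherwise the propagation probability is $0$), with ties broken consistently so that, for each $v$, the chosen paths into $v$ form an in-arborescence rooted at $v$. MIIA: for $v\in V(G)$ and a threshold $\theta\in(0,1]$, $MIIA(v,\theta)$ is the union of the paths $p^{max}_{u,v}$ over all $u\in V(G)\setminus\{v\}$ with $\mathcal{P}(p^{max}_{u,v})\ge\theta$ (together with the root $v$ itself). Activation probability: for $S\subseteq V(G)$ and $A=MIIA(v,\theta)$, the number $ap(u,S,A)$ for nodes $u$ of $A$ is defined recursively: it equals $1$ if $u\in S$; it equals $0$ if $u\notin S$ and $u$ has no in-neighbour in $A$; otherwise it equals $1-\prod_{w}\bigl(1-ap(w,S,A)\,P_{wu}\bigr)$, the product being over the in-neighbours $w$ of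 $u$ in $A$. MIA diffusion model: the expected influence of $S\subseteq V(G)$ is $\sigma(S)=\sum_{v\in V(G)} ap(v,S,MIIA(v,\theta))$. BIM Game: the co-operative game $(\mathcal{N},\nu)$ with player set $\mathcal{N}=V(G)$ and utility $\nu:2^{V(G)}\to\mathbb{R}_{\ge 0}$, $\nu(S)=\sigma(S)$. Convexity: a co-operative game $(\mathcal{N},\nu)$ is convex if for all $S\subseteq T\subseteq\mathcal{N}$ and all $u\in\mathcal{N}\setminus T$, $\nu(S\cup\{u\})-\nu(S)\le\nu(T\cup\{u\})-\nu(T)$.
   Formalization: The formal theorem adds the hypothesis that some edge between two distinct nodes has influence probability at least θ; without it σ(S)=|S| (e.g. an edgeless network), the game is additive and hence convex, so the claim fails. *)

theory Defs
  imports "Graph_Theory.Graph_Theory" Complex_Main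
begin

text \<open>
  Arcs are ordered pairs, so an undirected edge is a pair of opposite arcs of equal probability.
\<close>

locale social_network = pair_fin_digraph G for G :: "'a pair_pre_digraph" +
  fixes P :: "'a \<times> 'a \<Rightarrow> real"
  assumes P_arc: "e \<in> parcs G \<Longrightarrow> 0 < P e \<and> P e \<le> 1"
    and P_non_arc: "e \<notin> parcs G \<Longrightarrow> P e = 0"

definition path_prob :: "('a \<times> 'a \<Rightarrow> real) \<Rightarrow> ('a \<times> 'a) awalk \<Rightarrow> real" where
  "path_prob P p = (\<Prod>e\<leftarrow>p. P e)"

definition joined :: "'a pair_pre_digraph \<Rightarrow> 'a \<Rightarrow> 'a \<Rightarrow> bool" where
  "joined G u v \<longleftrightarrow> (\<exists>p. pre_digraph.apath G u p v)"

text \<open>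
  A selection of paths is a function \<open>pmax\<close>, where \<open>pmax u v\<close> is the path chosen from \<open>u\<close> to \<open>v\<close>.
  Its values are irrelevant if \<open>u = v\<close> or if there is no path from \<open>u\<close> to \<open>v\<close>.
\<close>

definition paths_into ::
    "('a \<Rightarrow> 'a \<Rightarrow> ('a \<times> 'a) awalk) \<Rightarrow> 'a set \<Rightarrow> 'a \<Rightarrow> 'a pair_pre_digraph" where
  "paths_into pmax U v =
     \<lparr> pverts = insert v (\<Union>u\<in>U. set (pawalk_verts u (pmax u v))),
       parcs = (\<Union>u\<in>U. set (pmax u v)) \<rparr>"

text \<open>
  The walk in the next definition is unique for the root \<open>r\<close> as well, so no arc leaves \<open>r\<close>.
\<close>

definition in_arborescence :: "'a pair_pre_digraph \<Rightarrow> 'a \<Rightarrow> bool" where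
  "in_arborescence A r \<longleftrightarrow>
     pair_wf_digraph A \<and> r \<in> pverts A \<and> (\<forall>u\<in>pverts A. \<exists>!p. pre_digraph.awalk A u p r)"

locale max_path_selection = social_network G P
  for G :: "'a pair_pre_digraph" and P :: "'a \<times> 'a \<Rightarrow> real" +
  fixes pmax :: "'a \<Rightarrow> 'a \<Rightarrow> ('a \<times> 'a) awalk"
  assumes pmax_path:
      "\<lbrakk> u \<noteq> v; joined G u v \<rbrakk> \<Longrightarrow> pre_digraph.apath G u (pmax u v) v"
    and pmax_max:
      "\<lbrakk> u \<noteq> v; pre_digraph.apath G u p v \<rbrakk> \<Longrightarrow> path_prob P p \<le> path_prob P (pmax u v)"
    and pmax_consistent:
      "v \<in> pverts G \<Longrightarrow>
         in_arborescence (paths_into pmax {u \<in> pverts G - {v}. joined G u v} v) v"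

definition prop_prob ::
    "'a pair_pre_digraph \<Rightarrow> ('a \<times> 'a \<Rightarrow> real) \<Rightarrow> ('a \<Rightarrow> 'a \<Rightarrow> ('a \<times> 'a) awalk) \<Rightarrow>
     'a \<Rightarrow> 'a \<Rightarrow> real" where
  "prop_prob G P pmax u v = (if joined G u v then path_prob P (pmax u v) else 0)"

definition MIIA ::
    "'a pair_pre_digraph \<Rightarrow> ('a \<times> 'a \<Rightarrow> real) \<Rightarrow> ('a \<Rightarrow> 'a \<Rightarrow> ('a \<times> 'a) awalk) \<Rightarrow>
     'a \<Rightarrow> real \<Rightarrow> 'a pair_pre_digraph" where
  "MIIA G P pmax v \<theta> = paths_into pmax {u \<in> pverts G - {v}. \<theta> \<le> prop_prob G P pmax u v} v"

text \<open>
  The recursion runs along the arcs of \<open>A\<close>. The equation \<open>ap_rec\<close> below holds on every finite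
  acyclic \<open>A\<close>, hence on every \<open>MIIA\<close> of a threshold \<open>\<theta> > 0\<close>.
\<close>

definition ap :: "('a \<times> 'a \<Rightarrow> real) \<Rightarrow> 'a \<Rightarrow> 'a set \<Rightarrow> 'a pair_pre_digraph \<Rightarrow> real" where
  "ap P u S A = wfrec (parcs A)
     (\<lambda>f u. if u \<in> S then 1
            else if {w. (w, u) \<in> parcs A} = {} then 0
            else 1 - (\<Prod>w | (w, u) \<in> parcs A. 1 - f w * P (w, u))) u"

lemma ap_rec:
  assumes "finite (parcs A)" and "acyclic (parcs A)"
  shows "ap P u S A =
     (if u \<in> S then 1
      else if {w. (w, u) \<in> parcs A} = {} then 0
      else 1 - (\<Prod>w | (w, u) \<in> parcs A. 1 - ap P w S A * P (w, u)))"
proof -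
  have "wf (parcs A)"
    using assms by (rule finite_acyclic_wf)
  then show ?thesis
    unfolding ap_def by (subst wfrec) (auto simp: cut_apply)
qed

lemma in_arborescence_acyclic:
  assumes "in_arborescence A r"
  shows "acyclic (parcs A)"
proof -
  interpret pair_wf_digraph A
    using assms by (simp add: in_arborescence_def)
  show ?thesis
  proof (rule acyclicI, intro allI notI)
    fix x assume "(x, x) \<in> (parcs A)\<^sup>+"
    then have "x \<rightarrow>\<^sup>+\<^bsub>with_proj A\<^esub> x" by simp
    then obtain c where c: "awalk x c x" "c \<noteq> []"
      by (auto simp: reachable1_awalk)
    then have "x \<in> pverts A" by auto
    with assms obtain p where p: "awalk x p r" "\<And>q. awalk x q r \<Longrightarrow> q = p"
      unfolding in_arborescence_def by metis
    have "awalk x (c @ p) r"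
      using c(1) p(1) by (rule awalk_appendI)
    from p(2)[OF this] c(2) show False by simp
  qed
qed

lemma (in max_path_selection) MIIA_acyclic:
  assumes "v \<in> pverts G" and "0 < \<theta>"
  shows "acyclic (parcs (MIIA G P pmax v \<theta>))"
proof (rule acyclic_subset[OF in_arborescence_acyclic[OF pmax_consistent[OF assms(1)]]])
  show "parcs (MIIA G P pmax v \<theta>)
      \<subseteq> parcs (paths_into pmax {u \<in> pverts G - {v}. joined G u v} v)"
    using assms(2) by (auto simp: MIIA_def paths_into_def prop_prob_def split: if_splits)
qed

definition influence ::
    "'a pair_pre_digraph \<Rightarrow> ('a \<times> 'a \<Rightarrow> real) \<Rightarrow> ('a \<Rightarrow> 'a \<Rightarrow> ('a \<times> 'a) awalk) \<Rightarrow>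
     real \<Rightarrow> 'a set \<Rightarrow> real" where
  "influence G P pmax \<theta> S = (\<Sum>v\<in>pverts G. ap P v S (MIIA G P pmax v \<theta>))"

text \<open>
  A co-operative game is a pair of a player set and a utility; only the values of the utility
  on subsets of the player set matter.
\<close>

type_synonym 'a coop_game = "'a set \<times> ('a set \<Rightarrow> real)"

definition convex_game :: "'a coop_game \<Rightarrow> bool" where
  "convex_game g \<longleftrightarrow> (case g of (N, \<nu>) \<Rightarrow>
     \<forall>S T. S \<subseteq> T \<and> T \<subseteq> N \<longrightarrow>
       (\<forall>u\<in>N - T. \<nu> (S \<union> {u}) - \<nu> S \<le> \<nu> (T \<union> {u}) - \<nu> T))"

definition BIM_game ::
    "'a pair_pre_digraph \<Rightarrow> ('a \<times> 'a \<Rightarrow> real) \<Rightarrow> ('a \<Rightarrow> 'a \<Rightarrow> ('a \<times> 'a) awalk) \<Rightarrow>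
     real \<Rightarrow> 'a coop_game" where
  "BIM_game G P pmax \<theta> = (pverts G, influence G P pmax \<theta>)"

end

theory Submission
  imports Defs
begin

text \<open>
  Convexity fails for the player \<open>a\<close> at the tail of an arc \<open>(a, b)\<close> with \<open>\<theta> \<le> P (a, b)\<close>. Joining
  the empty coalition, \<open>a\<close> gains \<open>1\<close> for itself and a positive amount at \<open>b\<close>, because
  \<open>MIIA(b, \<theta>)\<close> contains a path from \<open>a\<close> to \<open>b\<close>. Joining the coalition of all the other players,
  \<open>a\<close> gains at most \<open>1\<close>: every other node is active already.
\<close>

context
  fixes A :: "'a pair_pre_digraph" and P :: "'a \<times> 'a \<Rightarrow> real"
  assumes finite_arcs: "finite (parcs A)"
    and acyclic_arcs: "acyclic (parcs A)"
    and prob_arcs: "e \<in> parcs A \<Longrightarrow> 0 < P e \<and> P e \<le> 1"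
begin

text \<open>Arc probabilities lie in (0, 1], so by induction along the arcs every factor
  \<open>1 - ap P w S A * P (w, u)\<close> lies in [0, 1], and hence so does the product.\<close>

lemma ap_bounds: "0 \<le> ap P u S A \<and> ap P u S A \<le> 1"
proof (induction u rule: wf_induct_rule[OF finite_acyclic_wf[OF finite_arcs acyclic_arcs]])
  case (1 u)
  have "0 \<le> 1 - ap P w S A * P (w, u) \<and> 1 - ap P w S A * P (w, u) \<le> 1"
    if "(w, u) \<in> parcs A" for w
    using 1[OF that] prob_arcs[OF that] by (simp add: mult_le_one)
  then have "0 \<le> (\<Prod>w | (w, u) \<in> parcs A. 1 - ap P w S A * P (w, u))"
    and "(\<Prod>w | (w, u) \<in> parcs A. 1 - ap P w S A * P (w, u)) \<le> 1"
    by (auto intro!: prod_nonneg prod_le_1)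
  then show ?case
    by (subst (1 2) ap_rec[OF finite_arcs acyclic_arcs]) auto
qed

text \<open>By induction every factor of the product is 1, so nothing is activated without a
  seed.\<close>

lemma ap_empty: "ap P u {} A = 0"
proof (induction u rule: wf_induct_rule[OF finite_acyclic_wf[OF finite_arcs acyclic_arcs]])
  case (1 u)
  then show ?case
    by (subst ap_rec[OF finite_arcs acyclic_arcs]) simp
qed

lemma ap_seed: "u \<in> S \<Longrightarrow> ap P u S A = 1"
  by (subst ap_rec[OF finite_arcs acyclic_arcs]) simp

text \<open>The factor of \<open>w\<close> is strictly below 1 and the remaining factors lie in
  [0, 1], so the product stays below 1.\<close>

lemma ap_pos_step:
  assumes "(w, u) \<in> parcs A" and "0 < ap P w S A"
  shows "0 < ap P u S A"
proof -
  let ?I = "{w. (w, u) \<in> parcs A}"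
  let ?f = "\<lambda>w. 1 - ap P w S A * P (w, u)"
  have "finite ?I"
    \<comment> \<open>The in-neighbours of \<open>u\<close> are among the first components of the
      finitely many arcs.\<close>
    by (rule finite_subset[OF _ finite_imageI[OF finite_arcs, of fst]]) force
  have f: "0 \<le> ?f x \<and> ?f x \<le> 1" if "x \<in> ?I" for x
    using ap_bounds[of x S] prob_arcs[of "(x, u)"] that by (simp add: mult_le_one)
  have "prod ?f ?I = ?f w * prod ?f (?I - {w})"
    using \<open>finite ?I\<close> assms(1) by (intro prod.remove) auto
  also have "\<dots> \<le> ?f w * 1"
    using f assms(1) by (intro mult_left_mono prod_le_1) auto
  also have "\<dots> < 1"
    using assms prob_arcs[OF assms(1)] by simp
  finally have "prod ?f ?I < 1" .
  then show ?thesis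
    using assms(1) by (subst ap_rec[OF finite_arcs acyclic_arcs]) auto
qed

text \<open>Positivity spreads from a seed along arcs, so reachability alone suffices and no path
  probability has to be computed.\<close>

lemma ap_pos_reachable:
  assumes "(w, u) \<in> (parcs A)\<^sup>*" and "w \<in> S"
  shows "0 < ap P u S A"
  using assms(1)
proof induction
  case base
  show ?case using ap_seed[OF assms(2)] by simp
next
  case (step x y)
  then show ?case by (blast intro: ap_pos_step)
qed

end

text \<open>Only the arcs of the walk itself are used, so the connection carries over to any graph
  that contains them, in particular to an \<open>MIIA\<close>.\<close>

lemma (in pair_pre_digraph) cas_rtrancl: "cas u p v \<Longrightarrow> (u, v) \<in> (set p)\<^sup>*"
proof (induction p arbitrary: u)
  case (Cons e p)
  then have "(snd e, v) \<in> (set (e # p))\<^sup>*"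
    by (auto intro: rtrancl_mono[THEN subsetD, of "set p"])
  moreover from Cons.prems have "u = fst e" by simp
  ultimately show ?case
    by (intro converse_rtrancl_into_rtrancl[of u "snd e"]) simp_all
qed simp

context max_path_selection
begin

text \<open>A positive threshold rules out the default value 0 of \<open>prop_prob\<close>, so every
  selected \<open>pmax u v\<close> is a genuine path of \<open>G\<close>.\<close>

lemma MIIA_arcs_subset:
  assumes "0 < \<theta>"
  shows "parcs (MIIA G P pmax v \<theta>) \<subseteq> parcs G"
proof -
  have "set (pmax u v) \<subseteq> parcs G" if "u \<noteq> v" "\<theta> \<le> prop_prob G P pmax u v" for u
  proof -
    have "joined G u v"
      using that(2) assms by (auto simp: prop_prob_def split: if_splits)
    then show ?thesis
      using pmax_path[OF that(1)] by (auto simp: apath_def awalk_def)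
  qed
  then show ?thesis
    by (auto simp: MIIA_def paths_into_def)
qed

text \<open>The chosen path from \<open>u\<close> to \<open>v\<close> may avoid the arc
  \<open>(u, v)\<close>. It is at least as probable as this one-arc path, however, so it passes the
  threshold and its arcs enter the \<open>MIIA\<close>.\<close>

lemma MIIA_arc_reachable:
  assumes "(u, v) \<in> parcs G" and "u \<noteq> v" and "\<theta> \<le> P (u, v)"
  shows "(u, v) \<in> (parcs (MIIA G P pmax v \<theta>))\<^sup>*"
proof -
  have arc: "apath u [(u, v)] v"
    using assms(1,2) in_arcsD1 by (auto simp: apath_def awalk_def)
  then have joined: "joined G u v"
    by (auto simp: joined_def)
  have "\<theta> \<le> prop_prob G P pmax u v"
    using pmax_max[OF assms(2) arc] assms(3) joined by (simp add: prop_prob_def path_prob_def)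
  then have "set (pmax u v) \<subseteq> parcs (MIIA G P pmax v \<theta>)"
    using assms(1,2) in_arcsD1 by (auto simp: MIIA_def paths_into_def)
  moreover have "(u, v) \<in> (set (pmax u v))\<^sup>*"
    using pmax_path[OF assms(2) joined] by (intro cas_rtrancl) (auto simp: apath_def awalk_def)
  ultimately show ?thesis
    using rtrancl_mono by blast
qed

lemma not_convex_BIM_game:
  assumes "0 < \<theta>" and "(a, b) \<in> parcs G" and "a \<noteq> b" and "\<theta> \<le> P (a, b)"
  shows "\<not> convex_game (BIM_game G P pmax \<theta>)"
proof
  let ?A = "\<lambda>v. MIIA G P pmax v \<theta>"
  let ?\<nu> = "influence G P pmax \<theta>"
  let ?V = "pverts G"
  have a: "a \<in> ?V" and b: "b \<in> ?V"
    using in_arcsD1 in_arcsD2 assms(2) by auto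
  have MIIA: "finite (parcs (?A v))" "acyclic (parcs (?A v))"
    "\<And>e. e \<in> parcs (?A v) \<Longrightarrow> 0 < P e \<and> P e \<le> 1" if "v \<in> ?V" for v
    using MIIA_arcs_subset[OF assms(1)] MIIA_acyclic[OF that assms(1)] P_arc
    by (auto intro: finite_subset[OF _ pair_finite_arcs])
  have bounds: "0 \<le> ap P u S (?A v) \<and> ap P u S (?A v) \<le> 1" if "v \<in> ?V" for u v S
    by (rule ap_bounds[OF MIIA[OF that]])
  have seed: "ap P u S (?A v) = 1" if "v \<in> ?V" and "u \<in> S" for u v S
    by (rule ap_seed[OF MIIA[OF that(1)] that(2)])
  assume "convex_game (BIM_game G P pmax \<theta>)"
  then have "?\<nu> ({} \<union> {a}) - ?\<nu> {} \<le> ?\<nu> ((?V - {a}) \<union> {a}) - ?\<nu> (?V - {a})"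
    unfolding convex_game_def BIM_game_def using a by blast
  then have convex: "?\<nu> {a} - ?\<nu> {} \<le> ?\<nu> ?V - ?\<nu> (?V - {a})"
    using a by (simp add: insert_absorb)
  have "?\<nu> {} = 0"
    by (simp add: influence_def ap_empty[OF MIIA])
  moreover have "1 < ?\<nu> {a}"
  proof -
    have "0 < ap P b {a} (?A b)"
      using MIIA_arc_reachable[OF assms(2-4)] by (intro ap_pos_reachable[OF MIIA[OF b]]) auto
    then have "1 < (\<Sum>v\<in>{a, b}. ap P v {a} (?A v))"
      using assms(3) seed[OF a, of a] by simp
    also have "\<dots> \<le> ?\<nu> {a}"
      \<comment> \<open>All other summands are nonnegative.\<close>
      unfolding influence_def using a b bounds by (intro sum_mono2) auto
    finally show ?thesis .
  qed
  moreover have "?\<nu> ?V - ?\<nu> (?V - {a}) \<le> 1"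
  proof -
    have "?\<nu> ?V - ?\<nu> (?V - {a}) = (\<Sum>v\<in>?V. ap P v ?V (?A v) - ap P v (?V - {a}) (?A v))"
      by (simp add: influence_def sum_subtractf)
    also have "\<dots> \<le> (\<Sum>v\<in>?V. if v = a then 1 else 0)"
    proof (rule sum_mono)
      fix v assume v: "v \<in> ?V"
      show "ap P v ?V (?A v) - ap P v (?V - {a}) (?A v) \<le> (if v = a then 1 else 0)"
        \<comment> \<open>A node \<open>v \<noteq> a\<close> is a seed in both coalitions, so its
          difference is 1 - 1 = 0. For \<open>v = a\<close> the first term is 1 and the second is
          nonnegative.\<close>
        using bounds[OF v, of v "?V - {a}"] v by (auto simp: seed)
    qed
    also have "\<dots> = 1"
      using a by simp
    finally show ?thesis .
  qed
  ultimately show False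
    using convex by simp
qed

end

text \<open>The hypothesis on an arc excludes a degenerate case. Probabilities are at most 1, so a
  path that passes the threshold has only arcs that pass it. If no arc between distinct nodes does,
  every \<open>MIIA\<close> is a bare root, the influence of a coalition is its cardinality, and
  this additive game is convex.\<close>

theorem proposition2:
  fixes G :: "'a pair_pre_digraph"
    and P :: "'a \<times> 'a \<Rightarrow> real"
    and pmax :: "'a \<Rightarrow> 'a \<Rightarrow> ('a \<times> 'a) awalk"
    and \<theta> :: real
  assumes "max_path_selection G P pmax"
    and "0 < \<theta>" and "\<theta> \<le> 1"
    and "\<exists>u v. u \<noteq> v \<and> (u, v) \<in> parcs G \<and> \<theta> \<le> P (u, v)"
  shows "\<not> convex_game (BIM_game G P pmax \<theta>)"
  using assms max_path_selection.not_convex_BIM_game by metis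

end
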